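(* Let $\mathcal{H}$ be a real Hilbert space and let $f:\mathcal{H}\to\mathbb{R}$ be convex and continuously differentiable with $\operatorname{argmin} f\ne\emptyset$. Let $\alpha>3$, $\lambda>0$, $s_0>0$, $t_0\ge0$. Consider the second-order systems $$\text{(HB)}\quad\begin{cases}\ddot y(t)+\lambda\dot y(t)+\left(\frac{\lambda s_0}{\alpha-1}\right)^2\exp\left(\frac{2\lambda(t-t_0)}{\alpha-1}\right)\nabla f(y(t))=0\quad (t\ge t_0),\\ y(t_0)=y_0,\quad\dot y(t_0)=y_1,\end{cases}$$ and $$\text{(AVD)}\quad\begin{cases}\ddot x(s)+\frac{\alpha}{s}\dot x(s)+\nabla f(x(s))=0\quad (s\ge s_0),\\ x(s_0)=x_0,\quad\dot x(s_0)=x_1,\end{cases}$$ with $y_0,y_1,x_0,x_1\in\mathcal{H}$. Then the following statements are true. (i) If $y:[t_0,+\infty)\to\mathcal{H}$ is a solution of (HB) and $\tau:[s_0,+\infty)\to[t_0,+\infty)$ is given by $\tau(s):=\frac{\alpha-1}{\lambda}\ln\left(\frac{s}{s_0}\right)+t_0$, then $x:[s_0,+\infty)\to\mathcal{H}$, $x(s):=y(\tau(s))$, is a solution of (AVD) for the initial conditions $$x(s_0)=y_0\quad\text{and}\quad\dot x(s_0)=\frac{\alpha-1}{\lambda s_0}y_1 .$$ (ii) If $x:[s_0,+\infty)\to\mathcal{H}$ is a solution of (AVD) and $\sigma:[t_0,+\infty)\to[s_0,+\infty)$ is given by $\sigma(t):=s_0\exp\left(\frac{\lambda(t-t_0)}{\alpha-1}\right)$,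 then $y:[t_0,+\infty)\to\mathcal{H}$, $y(t):=x(\sigma(t))$, is a solution of (HB) for the initial conditions $$y(t_0)=x_0\quad\text{and}\quad\dot y(t_0)=\frac{\lambda s_0}{\alpha-1}x_1 .$$
   Context: A solution is a twice continuously differentiable function satisfying the respective equation at every time in its (closed, unbounded) interval of definition and the stated initial conditions (derivatives at the initial time are one-sided). *)

theory Defs
  imports "HOL-Analysis.Analysis"
begin

definition continuously_differentiable :: "('a::real_normed_vector \<Rightarrow> 'b::real_normed_vector) \<Rightarrow> bool"
  where "continuously_differentiable f \<longleftrightarrow>
    (\<exists>f' :: 'a \<Rightarrow> 'a \<Rightarrow>\<^sub>L 'b.
       (\<forall>x. (f has_derivative blinfun_apply (f' x)) (at x)) \<and> continuous_on UNIV f')"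

definition gradient :: "('a::real_inner \<Rightarrow> real) \<Rightarrow> 'a \<Rightarrow> 'a"
  where "gradient f x = (THE D. GDERIV f x :> D)"

text \<open>On a Hilbert space the definite description above is proper at every point of
  Frechet differentiability, by the Riesz representation theorem.\<close>

lemma riesz_representation:
  fixes \<phi> :: "'a::{real_inner, complete_space} \<Rightarrow> real"
  assumes "bounded_linear \<phi>"
  shows "\<exists>v. \<forall>h. \<phi> h = inner h v"
proof -
  interpret bounded_linear \<phi> by fact
  define F where "F x = inner x x / 2 - \<phi> x" for x
  define m where "m = Inf (range F)"
  obtain K where K: "\<And>x. norm (\<phi> x) \<le> norm x * K" using bounded by blast
  have lower: "- (K^2 / 2) \<le> F x" for x
  proof -
    have "0 \<le> (norm x - K)^2" by simp
    moreover have "\<phi> x \<le> norm x * K" using K[of x] by simp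
    ultimately show ?thesis
      by (simp add: F_def power2_norm_eq_inner[symmetric] power2_diff)
  qed
  then have bdd: "bdd_below (range F)" by (auto simp: bdd_below_def)
  have m_le: "m \<le> F x" for x
    unfolding m_def by (rule cInf_lower[OF _ bdd]) simp
  have "\<exists>x. F x < m + 1 / real (Suc n)" for n
  proof -
    have "Inf (range F) < m + 1 / real (Suc n)" by (simp add: m_def)
    then show ?thesis using cInf_less_iff[OF _ bdd] by auto
  qed
  then obtain X where X: "\<And>n. F (X n) < m + 1 / real (Suc n)" by metis
  have par: "inner (u - w) (u - w) \<le> 4 * (F u - m) + 4 * (F w - m)" for u w
  proof -
    have "F ((1/2) *\<^sub>R (u + w)) = (F u + F w) / 2 - inner (u - w) (u - w) / 8"
      by (simp add: F_def scaleR add inner_add_left inner_add_right inner_diff_left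
          inner_diff_right inner_commute field_simps)
    then have "m \<le> (F u + F w) / 2 - inner (u - w) (u - w) / 8"
      using m_le[of "(1/2) *\<^sub>R (u + w)"] by metis
    then show ?thesis by argo
  qed
  have "Cauchy X"
  proof (rule metric_CauchyI)
    fix e :: real assume e: "0 < e"
    obtain N :: nat where N: "8 / e^2 < real N" using reals_Archimedean2 by blast
    have "dist (X i) (X j) < e" if "N \<le> i" "N \<le> j" for i j
    proof -
      have N': "8 / real (Suc N) < e^2"
        using N e by (simp add: field_simps)
          (smt (verit) mult_left_mono zero_le_power2 zero_less_power2)
      have b: "F (X k) - m < 1 / real (Suc N)" if "N \<le> k" for k
      proof -
        have "1 / real (Suc k) \<le> 1 / real (Suc N)" using that by (simp add: frac_le)
        then show ?thesis using X[of k] by linarith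
      qed
      have "(norm (X i - X j))^2 < e^2"
        using par[of "X i" "X j"] b[OF that(1)] b[OF that(2)] N'
        by (simp add: power2_norm_eq_inner)
      then show ?thesis using e by (simp add: dist_norm power_less_imp_less_base)
    qed
    then show "\<exists>M. \<forall>i\<ge>M. \<forall>j\<ge>M. dist (X i) (X j) < e" by blast
  qed
  then obtain v where v: "X \<longlonglongrightarrow> v" using Cauchy_convergent convergent_def by blast
  have "(\<lambda>n. F (X n)) \<longlonglongrightarrow> F v"
    unfolding F_def by (intro tendsto_intros v tendsto) simp
  moreover have "(\<lambda>n. m + 1 / real (Suc n)) \<longlonglongrightarrow> m + 0"
    by (intro tendsto_add tendsto_const LIMSEQ_Suc lim_1_over_n)
  ultimately have "F v \<le> m + 0"
    using X by (intro LIMSEQ_le) (auto intro: less_imp_le)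
  then have Fv: "F v \<le> F x" for x using m_le[of x] by simp
  have "\<phi> h = inner h v" for h
  proof (cases "h = 0")
    case False
    define c where "c = inner h v - \<phi> h"
    define t where "t = - c / inner h h"
    have hh: "inner h h > 0" using False by simp
    have "F (v + t *\<^sub>R h) = F v + t * c + t^2 * inner h h / 2"
      by (simp add: F_def c_def add scaleR inner_add_left inner_add_right inner_commute
          power2_eq_square algebra_simps add_divide_distrib)
    also have "\<dots> = F v - c^2 / (2 * inner h h)"
      using hh by (simp add: t_def power2_eq_square divide_simps)
    finally have "c^2 / (2 * inner h h) \<le> 0" using Fv[of "v + t *\<^sub>R h"] by linarith
    then have "c = 0" using hh by (simp add: divide_le_0_iff)
    then show ?thesis by (simp add: c_def)
  qed (simp add: zero)
  then show ?thesis by blast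
qed

lemma GDERIV_gradient:
  fixes f :: "'a::{real_inner, complete_space} \<Rightarrow> real"
  assumes "f differentiable (at x)"
  shows "GDERIV f x :> gradient f x"
proof -
  obtain f' where f': "(f has_derivative f') (at x)"
    using assms by (auto simp: differentiable_def)
  obtain v where "\<forall>h. f' h = inner h v"
    using riesz_representation[OF has_derivative_bounded_linear[OF f']] by blast
  then have "f' = (\<lambda>h. inner h v)" by blast
  then have v: "GDERIV f x :> v" using f' by (simp add: gderiv_def)
  have "D = v" if "GDERIV f x :> D" for D
  proof -
    have "(\<lambda>h. inner h D) = (\<lambda>h. inner h v)"
      using has_derivative_unique that v unfolding gderiv_def by blast
    then have "inner (D - v) (D - v) = 0" by (metis inner_diff_right diff_self)
    then show ?thesis by simp
  qed
  then show ?thesis unfolding gradient_def using v by (metis theI)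
qed

text \<open>Functions on \<open>{a..}\<close> are represented by total functions; derivatives
  are taken within \<open>{a..}\<close> (hence one-sided at \<open>a\<close>), so values below \<open>a\<close> are irrelevant,
  and \<open>u'\<close>, \<open>u''\<close> are uniquely determined on \<open>{a..}\<close>. The damping coefficient, usually written lambda,
  is called \<open>\<mu>\<close> here since \<open>\<lambda>\<close> is reserved.\<close>

definition has_C2_derivatives_from ::
    "(real \<Rightarrow> 'a::real_normed_vector) \<Rightarrow> (real \<Rightarrow> 'a) \<Rightarrow> (real \<Rightarrow> 'a) \<Rightarrow> real \<Rightarrow> bool"
  where "has_C2_derivatives_from u u' u'' a \<longleftrightarrow>
    (\<forall>t\<ge>a. (u has_vector_derivative u' t) (at t within {a..})) \<and>
    (\<forall>t\<ge>a. (u' has_vector_derivative u'' t) (at t within {a..})) \<and>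
    continuous_on {a..} u''"

definition HB_solution ::
    "('a::real_inner \<Rightarrow> real) \<Rightarrow> real \<Rightarrow> real \<Rightarrow> real \<Rightarrow> real \<Rightarrow> 'a \<Rightarrow> 'a \<Rightarrow> (real \<Rightarrow> 'a) \<Rightarrow> bool"
  where "HB_solution f \<alpha> \<mu> s\<^sub>0 t\<^sub>0 y\<^sub>0 y\<^sub>1 y \<longleftrightarrow>
    (\<exists>y' y''. has_C2_derivatives_from y y' y'' t\<^sub>0 \<and>
      (\<forall>t\<ge>t\<^sub>0. y'' t + \<mu> *\<^sub>R y' t
          + ((\<mu> * s\<^sub>0 / (\<alpha> - 1))\<^sup>2 * exp (2 * \<mu> * (t - t\<^sub>0) / (\<alpha> - 1))) *\<^sub>R gradient f (y t) = 0) \<and>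
      y t\<^sub>0 = y\<^sub>0 \<and> y' t\<^sub>0 = y\<^sub>1)"

definition AVD_solution ::
    "('a::real_inner \<Rightarrow> real) \<Rightarrow> real \<Rightarrow> real \<Rightarrow> 'a \<Rightarrow> 'a \<Rightarrow> (real \<Rightarrow> 'a) \<Rightarrow> bool"
  where "AVD_solution f \<alpha> s\<^sub>0 x\<^sub>0 x\<^sub>1 x \<longleftrightarrow>
    (\<exists>x' x''. has_C2_derivatives_from x x' x'' s\<^sub>0 \<and>
      (\<forall>s\<ge>s\<^sub>0. x'' s + (\<alpha> / s) *\<^sub>R x' s + gradient f (x s) = 0) \<and>
      x s\<^sub>0 = x\<^sub>0 \<and> x' s\<^sub>0 = x\<^sub>1)"

end

theory Submission
  imports Defs
begin

text \<open>Both systems are the same equation in two time scales. Put c = (\<alpha> - 1) /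
  \<open>\<mu>\<close>. For x = y o \<tau> with \<tau>' = c / s and \<tau>'' = - c /
  \<open>s\<^sup>2\<close>, the chain rule turns x'' + (\<alpha> / s) x' into
  \<open>(c / s)\<^sup>2\<close> (y'' + \<open>\<mu>\<close> y') at \<tau>(s), because (\<alpha> -
  1) c = \<open>\<mu> * c\<^sup>2\<close>. The exponential weight of (HB) at time \<tau>(s) equals
  \<open>(s / c)\<^sup>2\<close>, so the left side of (AVD) is \<open>(c / s)\<^sup>2\<close> times
  that of (HB), and one vanishes with the other. The inverse time change \<sigma> satisfies
  \<sigma>' = r \<sigma> and \<sigma>'' = \<open>r\<^sup>2\<close> \<sigma> with r = 1 / c, and
  gives the converse by the same computation. The analytic content is the second-order chain rule
  \<open>has_C2_derivatives_from_compose\<close>; the two transfer lemmas do the algebra.\<close>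

text \<open>Chain rule for one-sided derivatives. Since \<phi> maps into \<open>{a..}\<close>,
  derivatives of u within \<open>{a..}\<close> restrict to the image of \<phi>, also where \<phi>
  hits the endpoint a. The function w is separate from the composition because total functions
  standing for functions on a half-line need to agree only there.\<close>

lemma has_C2_derivatives_from_compose:
  fixes u :: "real \<Rightarrow> 'a::real_normed_vector" and \<phi> :: "real \<Rightarrow> real"
  assumes u: "has_C2_derivatives_from u u' u'' a"
    and \<phi>: "has_C2_derivatives_from \<phi> \<phi>' \<phi>'' b"
    and maps: "\<phi> \<in> {b..} \<rightarrow> {a..}"
    and w: "\<And>s. s \<ge> b \<Longrightarrow> w s = u (\<phi> s)"
  shows "has_C2_derivatives_from w (\<lambda>s. \<phi>' s *\<^sub>R u' (\<phi> s))
           (\<lambda>s. (\<phi>' s)\<^sup>2 *\<^sub>R u'' (\<phi> s) + \<phi>'' s *\<^sub>R u' (\<phi> s)) b"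
proof -
  have d\<phi>: "(\<phi> has_vector_derivative \<phi>' s) (at s within {b..})"
    and d\<phi>': "(\<phi>' has_vector_derivative \<phi>'' s) (at s within {b..})" if "s \<ge> b" for s
    using \<phi> that by (auto simp: has_C2_derivatives_from_def)
  have cont: "continuous_on {b..} \<phi>" "continuous_on {b..} \<phi>'" "continuous_on {b..} \<phi>''"
      "continuous_on {a..} u'" "continuous_on {a..} u''"
    using u \<phi> by (auto simp: has_C2_derivatives_from_def continuous_on_eq_continuous_within
        intro: has_vector_derivative_continuous)
  have image: "\<phi> ` {b..} \<subseteq> {a..}"
    using maps by auto
  \<comment> \<open>Stated for a generic g since it is applied twice: to \<open>u\<close>, and to
    \<open>u'\<close> for the second derivative.\<close>
  have chain: "((\<lambda>s. g (\<phi> s)) has_vector_derivative \<phi>' s *\<^sub>R g' (\<phi> s)) (at s within {b..})"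
    if g: "\<forall>t\<ge>a. (g has_vector_derivative g' t) (at t within {a..})" and s: "s \<ge> b"
    for g g' :: "real \<Rightarrow> 'a" and s
  proof -
    have "(g has_vector_derivative g' (\<phi> s)) (at (\<phi> s) within \<phi> ` {b..})"
      using g s image by (auto intro: has_vector_derivative_within_subset)
    from vector_diff_chain_within[OF d\<phi>[OF s] this] show ?thesis
      by (simp add: o_def)
  qed
  have "(w has_vector_derivative \<phi>' s *\<^sub>R u' (\<phi> s)) (at s within {b..})" if s: "s \<ge> b" for s
  proof (rule has_vector_derivative_transform)
    show "((\<lambda>s. u (\<phi> s)) has_vector_derivative \<phi>' s *\<^sub>R u' (\<phi> s)) (at s within {b..})"
      using u s by (intro chain) (auto simp: has_C2_derivatives_from_def)
  qed (use s w in auto)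
  moreover have "((\<lambda>s. \<phi>' s *\<^sub>R u' (\<phi> s)) has_vector_derivative
      (\<phi>' s)\<^sup>2 *\<^sub>R u'' (\<phi> s) + \<phi>'' s *\<^sub>R u' (\<phi> s)) (at s within {b..})" if s: "s \<ge> b" for s
  proof -
    have "((\<lambda>s. u' (\<phi> s)) has_vector_derivative \<phi>' s *\<^sub>R u'' (\<phi> s)) (at s within {b..})"
      using u s by (intro chain) (auto simp: has_C2_derivatives_from_def)
    moreover have "(\<phi>' has_real_derivative \<phi>'' s) (at s within {b..})"
      using d\<phi>'[OF s] by (simp add: has_real_derivative_iff_has_vector_derivative)
    ultimately show ?thesis
      by (auto dest: has_vector_derivative_scaleR simp: power2_eq_square)
  qed
  moreover have "continuous_on {b..} (\<lambda>s. (\<phi>' s)\<^sup>2 *\<^sub>R u'' (\<phi> s) + \<phi>'' s *\<^sub>R u' (\<phi> s))"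
    using image cont by (intro continuous_intros) (auto intro: continuous_on_compose2)
  ultimately show ?thesis
    by (simp add: has_C2_derivatives_from_def)
qed

lemma has_C2_derivatives_from_ln:
  fixes c k d b :: real
  assumes "k > 0" "b > 0"
  shows "has_C2_derivatives_from (\<lambda>s. c * ln (s / k) + d) (\<lambda>s. c / s) (\<lambda>s. - c / s\<^sup>2) b"
  unfolding has_C2_derivatives_from_def has_real_derivative_iff_has_vector_derivative[symmetric]
  using assms
  by (auto intro!: derivative_eq_intros continuous_intros simp: power2_eq_square)

text \<open>Each derivative is written as a multiple of the function itself, so that folding
  \<sigma> later yields r \<sigma> and \<open>r\<^sup>2\<close> \<sigma>.\<close>

lemma has_C2_derivatives_from_exp:
  fixes k r d b :: real
  shows "has_C2_derivatives_from (\<lambda>t. k * exp (r * (t - d)))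
           (\<lambda>t. r * (k * exp (r * (t - d)))) (\<lambda>t. r\<^sup>2 * (k * exp (r * (t - d)))) b"
  unfolding has_C2_derivatives_from_def has_real_derivative_iff_has_vector_derivative[symmetric]
  by (auto intro!: derivative_eq_intros continuous_intros simp: power2_eq_square)

text \<open>The logarithm is the time change whose speed c / s makes the factor in front of the
  gradient constant; its negative second derivative shifts the damping to \<alpha> / s.\<close>

lemma AVD_solution_if_HB_solution:
  fixes y :: "real \<Rightarrow> 'a::real_inner"
  assumes "\<alpha> > 1" "\<mu> > 0" "s\<^sub>0 > 0"
    and hb: "HB_solution f \<alpha> \<mu> s\<^sub>0 t\<^sub>0 y\<^sub>0 y\<^sub>1 y"
    and x: "\<And>s. s \<ge> s\<^sub>0 \<Longrightarrow> x s = y ((\<alpha> - 1) / \<mu> * ln (s / s\<^sub>0) + t\<^sub>0)"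
  shows "AVD_solution f \<alpha> s\<^sub>0 y\<^sub>0 (((\<alpha> - 1) / (\<mu> * s\<^sub>0)) *\<^sub>R y\<^sub>1) x"
proof -
  define c where "c = (\<alpha> - 1) / \<mu>"
  have c: "c > 0" and \<alpha>: "\<alpha> = \<mu> * c + 1"
    using assms by (auto simp: c_def)
  define \<tau> where "\<tau> s = c * ln (s / s\<^sub>0) + t\<^sub>0" for s
  have x\<tau>: "x s = y (\<tau> s)" if "s \<ge> s\<^sub>0" for s
    using x[OF that] by (simp add: \<tau>_def c_def)
  obtain y' y'' where C2: "has_C2_derivatives_from y y' y'' t\<^sub>0"
    and eq: "\<And>t. t \<ge> t\<^sub>0 \<Longrightarrow> y'' t + \<mu> *\<^sub>R y' t
          + ((\<mu> * s\<^sub>0 / (\<alpha> - 1))\<^sup>2 * exp (2 * \<mu> * (t - t\<^sub>0) / (\<alpha> - 1))) *\<^sub>R gradient f (y t) = 0"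
    and init: "y t\<^sub>0 = y\<^sub>0" "y' t\<^sub>0 = y\<^sub>1"
    using hb by (auto simp: HB_solution_def)
  have maps: "\<tau> \<in> {s\<^sub>0..} \<rightarrow> {t\<^sub>0..}"
    using c assms by (auto simp: \<tau>_def)
  let ?x' = "\<lambda>s. (c / s) *\<^sub>R y' (\<tau> s)"
  let ?x'' = "\<lambda>s. (c / s)\<^sup>2 *\<^sub>R y'' (\<tau> s) + (- c / s\<^sup>2) *\<^sub>R y' (\<tau> s)"
  have "has_C2_derivatives_from x ?x' ?x'' s\<^sub>0"
    using has_C2_derivatives_from_ln[of s\<^sub>0 s\<^sub>0 c t\<^sub>0, folded \<tau>_def] assms(3) x\<tau>
    by (intro has_C2_derivatives_from_compose[OF C2 _ maps]) auto
  moreover have "?x'' s + (\<alpha> / s) *\<^sub>R ?x' s + gradient f (x s) = 0" if s: "s \<ge> s\<^sub>0" for s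
  proof -
    let ?k = "(\<mu> * s\<^sub>0 / (\<alpha> - 1))\<^sup>2 * exp (2 * \<mu> * (\<tau> s - t\<^sub>0) / (\<alpha> - 1))"
    have pos: "s > 0"
      using s assms by linarith
    have "2 * \<mu> * (\<tau> s - t\<^sub>0) / (\<alpha> - 1) = 2 * ln (s / s\<^sub>0)"
      using c assms by (simp add: \<tau>_def \<alpha>)
    then have "exp (2 * \<mu> * (\<tau> s - t\<^sub>0) / (\<alpha> - 1)) = (s / s\<^sub>0)\<^sup>2"
      using pos assms by (simp add: exp_double)
    then have "?k = (s / c)\<^sup>2"
      using assms c by (simp add: \<alpha> power2_eq_square)
    \<comment> \<open>The squared speed of \<tau> cancels the exponential weight, which leaves the
      bare gradient of (AVD).\<close>
    then have k: "(c / s)\<^sup>2 * ?k = 1"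
      using pos c by (simp add: power2_eq_square)
    have "?x'' s + (\<alpha> / s) *\<^sub>R ?x' s
        = (c / s)\<^sup>2 *\<^sub>R y'' (\<tau> s) + (- c / s\<^sup>2 + \<alpha> / s * (c / s)) *\<^sub>R y' (\<tau> s)"
      by (simp only: scaleR_scaleR scaleR_add_left add.assoc)
    \<comment> \<open>Here the damping terms match: with \<alpha> = \<open>\<mu> * c + 1\<close>
      both sides are \<open>\<mu> * c\<^sup>2 / s\<^sup>2\<close>.\<close>
    also have "- c / s\<^sup>2 + \<alpha> / s * (c / s) = (c / s)\<^sup>2 * \<mu>"
      using pos by (simp add: \<alpha> power2_eq_square field_simps)
    finally have "?x'' s + (\<alpha> / s) *\<^sub>R ?x' s + gradient f (x s)
        = (c / s)\<^sup>2 *\<^sub>R (y'' (\<tau> s) + \<mu> *\<^sub>R y' (\<tau> s) + ?k *\<^sub>R gradient f (y (\<tau> s)))"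
      by (simp add: scaleR_add_right k x\<tau>[OF s])
    moreover have "\<tau> s \<ge> t\<^sub>0"
      using maps s by auto
    ultimately show ?thesis
      by (simp add: eq)
  qed
  \<comment> \<open>As ln 1 = 0, \<tau> sends \<open>s\<^sub>0\<close> to \<open>t\<^sub>0\<close>;
    the initial velocity is scaled by the speed \<open>c / s\<^sub>0\<close> there.\<close>
  moreover have "x s\<^sub>0 = y\<^sub>0" "?x' s\<^sub>0 = ((\<alpha> - 1) / (\<mu> * s\<^sub>0)) *\<^sub>R y\<^sub>1"
    using x\<tau>[of s\<^sub>0] init assms(3) by (simp_all add: \<tau>_def c_def)
  ultimately show ?thesis
    unfolding AVD_solution_def by blast
qed

text \<open>For the exponential time change the squared speed
  \<open>(r * \<sigma> t)\<^sup>2\<close> is exactly the weight of (HB), so multiplying (AVD) at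
  time \<sigma>(t) by it produces (HB).\<close>

lemma HB_solution_if_AVD_solution:
  fixes x :: "real \<Rightarrow> 'a::real_inner"
  assumes "\<alpha> > 1" "\<mu> > 0" "s\<^sub>0 > 0"
    and avd: "AVD_solution f \<alpha> s\<^sub>0 x\<^sub>0 x\<^sub>1 x"
    and y: "\<And>t. t \<ge> t\<^sub>0 \<Longrightarrow> y t = x (s\<^sub>0 * exp (\<mu> * (t - t\<^sub>0) / (\<alpha> - 1)))"
  shows "HB_solution f \<alpha> \<mu> s\<^sub>0 t\<^sub>0 x\<^sub>0 ((\<mu> * s\<^sub>0 / (\<alpha> - 1)) *\<^sub>R x\<^sub>1) y"
proof -
  define r where "r = \<mu> / (\<alpha> - 1)"
  have r: "r > 0" and \<mu>: "\<mu> = r * (\<alpha> - 1)"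
    using assms by (auto simp: r_def)
  define \<sigma> where "\<sigma> t = s\<^sub>0 * exp (r * (t - t\<^sub>0))" for t
  have y\<sigma>: "y t = x (\<sigma> t)" if "t \<ge> t\<^sub>0" for t
    using y[OF that] by (simp add: \<sigma>_def r_def)
  obtain x' x'' where C2: "has_C2_derivatives_from x x' x'' s\<^sub>0"
    and eq: "\<And>s. s \<ge> s\<^sub>0 \<Longrightarrow> x'' s + (\<alpha> / s) *\<^sub>R x' s + gradient f (x s) = 0"
    and init: "x s\<^sub>0 = x\<^sub>0" "x' s\<^sub>0 = x\<^sub>1"
    using avd by (auto simp: AVD_solution_def)
  have maps: "\<sigma> \<in> {t\<^sub>0..} \<rightarrow> {s\<^sub>0..}"
    using r assms by (auto simp: \<sigma>_def)
  let ?y' = "\<lambda>t. (r * \<sigma> t) *\<^sub>R x' (\<sigma> t)"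
  let ?y'' = "\<lambda>t. (r * \<sigma> t)\<^sup>2 *\<^sub>R x'' (\<sigma> t) + (r\<^sup>2 * \<sigma> t) *\<^sub>R x' (\<sigma> t)"
  have "has_C2_derivatives_from y ?y' ?y'' t\<^sub>0"
    using has_C2_derivatives_from_exp[of s\<^sub>0 r t\<^sub>0 t\<^sub>0, folded \<sigma>_def] y\<sigma>
    by (intro has_C2_derivatives_from_compose[OF C2 _ maps]) auto
  moreover have "?y'' t + \<mu> *\<^sub>R ?y' t
      + ((\<mu> * s\<^sub>0 / (\<alpha> - 1))\<^sup>2 * exp (2 * \<mu> * (t - t\<^sub>0) / (\<alpha> - 1))) *\<^sub>R gradient f (y t) = 0"
    if t: "t \<ge> t\<^sub>0" for t
  proof -
    have \<sigma>: "\<sigma> t > 0"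
      using assms by (simp add: \<sigma>_def)
    \<comment> \<open>Pulling out the factor 2 lets \<open>exp_double\<close> expose the weight as a
      square.\<close>
    have "2 * \<mu> * (t - t\<^sub>0) / (\<alpha> - 1) = 2 * (r * (t - t\<^sub>0))"
      by (simp add: r_def)
    then have k: "(\<mu> * s\<^sub>0 / (\<alpha> - 1))\<^sup>2 * exp (2 * \<mu> * (t - t\<^sub>0) / (\<alpha> - 1)) = (r * \<sigma> t)\<^sup>2"
      by (simp only: exp_double) (simp add: \<sigma>_def r_def power_mult_distrib power_divide)
    have "?y'' t + \<mu> *\<^sub>R ?y' t
        = (r * \<sigma> t)\<^sup>2 *\<^sub>R x'' (\<sigma> t) + (r\<^sup>2 * \<sigma> t + \<mu> * (r * \<sigma> t)) *\<^sub>R x' (\<sigma> t)"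
      by (simp only: scaleR_scaleR scaleR_add_left add.assoc)
    \<comment> \<open>With \<open>\<mu>\<close> = r (\<alpha> - 1) both sides are
      \<open>\<alpha> * r\<^sup>2 * \<sigma> t\<close>.\<close>
    also have "r\<^sup>2 * \<sigma> t + \<mu> * (r * \<sigma> t) = (r * \<sigma> t)\<^sup>2 * (\<alpha> / \<sigma> t)"
      using \<sigma> by (simp add: \<mu> power2_eq_square field_simps)
    finally have "?y'' t + \<mu> *\<^sub>R ?y' t + (r * \<sigma> t)\<^sup>2 *\<^sub>R gradient f (y t)
        = (r * \<sigma> t)\<^sup>2 *\<^sub>R (x'' (\<sigma> t) + (\<alpha> / \<sigma> t) *\<^sub>R x' (\<sigma> t) + gradient f (x (\<sigma> t)))"
      by (simp only: scaleR_add_right scaleR_scaleR y\<sigma>[OF t])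
    moreover have "\<sigma> t \<ge> s\<^sub>0"
      using maps t by auto
    ultimately show ?thesis
      unfolding k by (simp only: eq scaleR_zero_right)
  qed
  moreover have "y t\<^sub>0 = x\<^sub>0" "?y' t\<^sub>0 = (\<mu> * s\<^sub>0 / (\<alpha> - 1)) *\<^sub>R x\<^sub>1"
    using y\<sigma>[of t\<^sub>0] init by (simp_all add: \<sigma>_def r_def)
  ultimately show ?thesis
    unfolding HB_solution_def by blast
qed

theorem proposition3p1:
  fixes f :: "'a::{real_inner, complete_space} \<Rightarrow> real"
    and \<alpha> \<mu> s\<^sub>0 t\<^sub>0 :: real
    and y\<^sub>0 y\<^sub>1 x\<^sub>0 x\<^sub>1 :: 'a
  assumes "convex_on UNIV f"
    and "continuously_differentiable f"
    and "{z. is_arg_min f (\<lambda>_. True) z} \<noteq> {}"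
    and "\<alpha> > 3" and "\<mu> > 0" and "s\<^sub>0 > 0" and "t\<^sub>0 \<ge> 0"
  shows
    "(\<forall>y \<tau> x.
        HB_solution f \<alpha> \<mu> s\<^sub>0 t\<^sub>0 y\<^sub>0 y\<^sub>1 y \<and>
        (\<forall>s\<ge>s\<^sub>0. \<tau> s = (\<alpha> - 1) / \<mu> * ln (s / s\<^sub>0) + t\<^sub>0) \<and>
        (\<forall>s\<ge>s\<^sub>0. x s = y (\<tau> s)) \<longrightarrow>
          \<tau> \<in> {s\<^sub>0..} \<rightarrow> {t\<^sub>0..} \<and>
          AVD_solution f \<alpha> s\<^sub>0 y\<^sub>0 (((\<alpha> - 1) / (\<mu> * s\<^sub>0)) *\<^sub>R y\<^sub>1) x) \<and>
     (\<forall>x \<sigma> y.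
        AVD_solution f \<alpha> s\<^sub>0 x\<^sub>0 x\<^sub>1 x \<and>
        (\<forall>t\<ge>t\<^sub>0. \<sigma> t = s\<^sub>0 * exp (\<mu> * (t - t\<^sub>0) / (\<alpha> - 1))) \<and>
        (\<forall>t\<ge>t\<^sub>0. y t = x (\<sigma> t)) \<longrightarrow>
          \<sigma> \<in> {t\<^sub>0..} \<rightarrow> {s\<^sub>0..} \<and>
          HB_solution f \<alpha> \<mu> s\<^sub>0 t\<^sub>0 x\<^sub>0 ((\<mu> * s\<^sub>0 / (\<alpha> - 1)) *\<^sub>R x\<^sub>1) y)"
proof (intro conjI allI impI)
  fix y x :: "real \<Rightarrow> 'a" and \<tau> :: "real \<Rightarrow> real"
  assume *: "HB_solution f \<alpha> \<mu> s\<^sub>0 t\<^sub>0 y\<^sub>0 y\<^sub>1 y \<and>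
    (\<forall>s\<ge>s\<^sub>0. \<tau> s = (\<alpha> - 1) / \<mu> * ln (s / s\<^sub>0) + t\<^sub>0) \<and> (\<forall>s\<ge>s\<^sub>0. x s = y (\<tau> s))"
  \<comment> \<open>The range condition holds because \<open>ln (s / s\<^sub>0)\<close> is
    nonnegative for \<open>s \<ge> s\<^sub>0\<close> and its coefficient is positive.\<close>
  then show "\<tau> \<in> {s\<^sub>0..} \<rightarrow> {t\<^sub>0..}"
    using assms(4-6) by auto
  from * show "AVD_solution f \<alpha> s\<^sub>0 y\<^sub>0 (((\<alpha> - 1) / (\<mu> * s\<^sub>0)) *\<^sub>R y\<^sub>1) x"
    using assms(4-6) by (intro AVD_solution_if_HB_solution) auto
next
  fix x y :: "real \<Rightarrow> 'a" and \<sigma> :: "real \<Rightarrow> real"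
  assume *: "AVD_solution f \<alpha> s\<^sub>0 x\<^sub>0 x\<^sub>1 x \<and>
    (\<forall>t\<ge>t\<^sub>0. \<sigma> t = s\<^sub>0 * exp (\<mu> * (t - t\<^sub>0) / (\<alpha> - 1))) \<and> (\<forall>t\<ge>t\<^sub>0. y t = x (\<sigma> t))"
  then show "\<sigma> \<in> {t\<^sub>0..} \<rightarrow> {s\<^sub>0..}"
    using assms(4-6) by auto
  from * show "HB_solution f \<alpha> \<mu> s\<^sub>0 t\<^sub>0 x\<^sub>0 ((\<mu> * s\<^sub>0 / (\<alpha> - 1)) *\<^sub>R x\<^sub>1) y"
    using assms(4-6) by (intro HB_solution_if_AVD_solution) auto
qed

end
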